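(* Let $a_1,a_2,\dots$ be a sequence of independent random variables taking values in the non-negative integers, where $a_n$ is geometric with parameter $2/(2+\log n)$, that is, $$\mathbf{P}(a_n=k)=\left(1-\frac{2}{2+\log n}\right)^k\frac{2}{2+\log n}$$ for all $n\ge 1$ and $k\ge 0$. Then almost surely the left diagonal $a_{(1,1)},a_{(2,1)},\dots$ of the Gilbreath array generated by $a_1,a_2,\dots$ takes values in $\{0,1\}$ after finitely many rows; that is, almost surely there is $i_0$ such that $a_{(i,1)}\in\{0,1\}$ for all $i\ge i_0$.
   Context: The Gilbreath array generated by an infinite sequence of real numbers $a_1,a_2,\dots$ is the array $a_{(i,j)}$, $i\ge 0$, $j\ge 1$, defined by $a_{(0,j)}=a_j$ and $a_{(i+1,j)}=|a_{(i,j)}-a_{(i,j+1)}|$. Here $\log$ is the natural logarithm. For $n=1$ the parameter is $1$ and $a_1=0$ almost surely (convention $0^0=1$). *)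

theory Defs
  imports "HOL-Probability.Probability"
begin

(* The generating sequence and the columns are indexed from 1; the entries with j = 0 are
   junk, and no entry with j >= 1 depends on them. *)
fun gilbreath_array :: "(nat \<Rightarrow> real) \<Rightarrow> nat \<Rightarrow> nat \<Rightarrow> real" where
  "gilbreath_array a 0 j = a j"
| "gilbreath_array a (Suc i) j = \<bar>gilbreath_array a i j - gilbreath_array a i (Suc j)\<bar>"

end

theory Submission
  imports Defs "HOL-Real_Asymp.Real_Asymp"
begin

text \<open>
  Two observations drive the proof.

  The first is deterministic. Suppose that the entries of some row lie between \<open>0\<close> and
  \<open>m\<close>. This bound persists in all later rows, and an entry equal to \<open>m\<close> can only arise
  from the pair \<open>{0, m}\<close>. Following this upwards, an entry equal to \<open>m\<close> that occurs \<open>s\<close>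
  rows further down forces the \<open>s + 1\<close> entries above it to lie in \<open>{0, m}\<close>
  (\<open>gilbreath_array_maximum_imp_block\<close>). Hence, as long as no row contains a block of
  \<open>s + 1\<close> consecutive entries in \<open>{0, m}\<close>, with \<open>m\<close> the current maximum and \<open>m \<ge> 2\<close>,
  the maximum drops by at least one every \<open>s\<close> rows
  (\<open>gilbreath_array_maximum_decreases\<close>) until all entries are in \<open>{0, 1}\<close>.

  The second is that such blocks are exponentially unlikely in their length. Raising the last
  generating value on which an entry depends by one changes that entry by exactly one
  (\<open>gilbreath_array_fun_upd_Suc\<close>). So, given all earlier generating values, the last one
  must fall into a set without two consecutive integers in order to put the entry into
  \<open>{0, m}\<close>, \<open>m \<ge> 2\<close>. A geometric variable with ratio \<open>q\<close> does so with
  probability at most \<open>1 / (1 + q)\<close>: shifting such a set by one gives a disjoint set and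
  multiplies its probability by \<open>q\<close> (\<open>prob_sparse_geometric_le\<close>). Here
  \<open>q = ln n / (2 + ln n) \<ge> 1/3\<close> for \<open>n \<ge> 3\<close>, so each further entry of a block
  costs a factor of at most \<open>3/4\<close> (\<open>prob_gilbreath_block_le\<close>).

  The entry in row \<open>i\<close> of the left diagonal depends on the first \<open>i + 1\<close> generating
  values. Let \<open>s\<close> be the integer part of the square root of \<open>i\<close>. The geometric tail
  makes all these values at most \<open>s\<close> with overwhelming probability, and the union bound over the fewer than \<open>(i + 1)\<^sup>2\<close> possible
  blocks of length about \<open>s\<close> excludes all of them. Then \<open>s (s - 1) \<le> i\<close> rows suffice to
  reduce the maximum from \<open>s\<close> to \<open>1\<close>. The exceptional probabilities are summable in
  \<open>i\<close>, and the Borel-Cantelli lemma concludes.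
\<close>

section \<open>Local structure of Gilbreath arrays\<close>

lemma gilbreath_array_cong:
  assumes "\<And>k. k \<in> {j..j+i} \<Longrightarrow> a k = b k"
  shows "gilbreath_array a i j = gilbreath_array b i j"
  using assms
proof (induction i arbitrary: j)
  case (Suc i)
  have "gilbreath_array a i j = gilbreath_array b i j"
    "gilbreath_array a i (Suc j) = gilbreath_array b i (Suc j)"
    by (rule Suc.IH; use Suc.prems in force)+
  then show ?case by simp
qed simp

lemma gilbreath_array_add:
  "gilbreath_array a (r + i) j = gilbreath_array (gilbreath_array a r) i j"
  by (induction i arbitrary: j) simp_all

lemma gilbreath_array_bounds:
  assumes "\<And>k. k \<in> {j..j+i} \<Longrightarrow> 0 \<le> a k \<and> a k \<le> m"
  shows "0 \<le> gilbreath_array a i j \<and> gilbreath_array a i j \<le> m"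
  using assms
proof (induction i arbitrary: j)
  case (Suc i)
  have "0 \<le> gilbreath_array a i j \<and> gilbreath_array a i j \<le> m"
    "0 \<le> gilbreath_array a i (Suc j) \<and> gilbreath_array a i (Suc j) \<le> m"
    by (rule Suc.IH; use Suc.prems in force)+
  then show ?case by auto
qed simp

lemma gilbreath_array_Ints:
  assumes "\<And>k. a k \<in> \<int>"
  shows "gilbreath_array a i j \<in> \<int>"
  using assms by (induction i arbitrary: j) auto

text \<open>
  One row up, neighbouring entries have differences in \<open>{0, m}\<close>, so whether an entry is
  in \<open>{0, m}\<close> does not change along the block; and the pair with difference \<open>m\<close> consists of
  \<open>0\<close> and \<open>m\<close>. That an entry equals \<open>m\<close> belongs to the conclusion because the
  induction needs it: a row of zeros says nothing about the row above it.
\<close>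

lemma gilbreath_array_maximum_imp_block:
  assumes "\<And>k. k \<in> {j..j+i} \<Longrightarrow> 0 \<le> a k \<and> a k \<le> m"
    and "gilbreath_array a i j = m" "m > 0"
  shows "(\<forall>k\<in>{j..j+i}. a k \<in> {0, m}) \<and> (\<exists>k\<in>{j..j+i}. a k = m)"
  using assms(1,2)
proof (induction i arbitrary: a)
  case (Suc i)
  define d where "d = gilbreath_array a 1"
  have d: "d k = \<bar>a k - a (Suc k)\<bar>" for k by (simp add: d_def)
  have range: "0 \<le> a k \<and> a k \<le> m" if "k \<in> {j..Suc (j+i)}" for k
    using Suc.prems(1) that by auto
  have d_range: "0 \<le> d k \<and> d k \<le> m" if "k \<in> {j..j+i}" for k
    using range[of k] range[of "Suc k"] that by (auto simp: d)
  have "gilbreath_array d i j = m"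
    using Suc.prems(2) gilbreath_array_add[of a 1 i j] by (simp add: d_def)
  from Suc.IH[OF d_range this] obtain l where block: "\<forall>k\<in>{j..j+i}. d k \<in> {0, m}"
    and l: "l \<in> {j..j+i}" "d l = m" by auto
  have step: "a (Suc k) \<in> {0, m} \<longleftrightarrow> a k \<in> {0, m}" if "k \<in> {j..j+i}" for k
    using block[rule_format, OF that] range[of k] range[of "Suc k"] that by (auto simp: d)
  have same: "a (j + t) \<in> {0, m} \<longleftrightarrow> a j \<in> {0, m}" if "t \<le> Suc i" for t
    using that by (induction t) (use step in auto)
  have l': "a l \<in> {0, m} \<and> (a l = m \<or> a (Suc l) = m)"
    using l range[of l] range[of "Suc l"] by (auto simp: d)
  have "a j \<in> {0, m}"
  proof -
    have "j + (l - j) = l" "l - j \<le> Suc i" using l(1) by auto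
    then show ?thesis using same[of "l - j"] l' by metis
  qed
  then have "a k \<in> {0, m}" if "k \<in> {j..j + Suc i}" for k
    using same[of "k - j"] that by auto
  moreover have "\<exists>k\<in>{j..j + Suc i}. a k = m"
    using l l' by (auto intro: bexI[of _ l] bexI[of _ "Suc l"])
  ultimately show ?case by blast
qed auto

text \<open>
  For integers, \<open>\<bar>c - x\<bar>\<close> changes by exactly one when \<open>x\<close> does, and the entry is an
  iteration of such folding maps, applied to the last generating value, whose centres depend on
  the earlier values only.
\<close>

lemma gilbreath_array_fun_upd_Suc:
  fixes x :: nat
  assumes "\<And>k. a k \<in> \<int>"
  shows "\<bar>gilbreath_array (a(j + i := real (Suc x))) i j
        - gilbreath_array (a(j + i := real x)) i j\<bar> = 1"
proof (induction i arbitrary: j)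
  case (Suc i)
  let ?u = "\<lambda>y. a(Suc (j + i) := real y)"
  have Z: "gilbreath_array (?u y) i' j' \<in> \<int>" for y i' j'
    by (intro gilbreath_array_Ints) (use assms in auto)
  have left: "gilbreath_array (?u (Suc x)) i j = gilbreath_array (?u x) i j"
    by (intro gilbreath_array_cong) auto
  have right: "\<bar>gilbreath_array (?u (Suc x)) i (Suc j) - gilbreath_array (?u x) i (Suc j)\<bar> = 1"
    using Suc.IH[of "Suc j"] unfolding add_Suc .
  obtain c y z where cyz: "gilbreath_array (?u x) i j = of_int c"
    "gilbreath_array (?u x) i (Suc j) = of_int y" "gilbreath_array (?u (Suc x)) i (Suc j) = of_int z"
    using Z by (metis Ints_cases)
  have "\<bar>z - y\<bar> = 1" using right unfolding cyz by linarith
  then have "\<bar>\<bar>c - z\<bar> - \<bar>c - y\<bar>\<bar> = 1" by arith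
  then have "\<bar>\<bar>of_int c - of_int z\<bar> - \<bar>of_int c - of_int y\<bar>\<bar> = (1::real)"
    by linarith
  then show ?case
    unfolding gilbreath_array.simps left cyz add_Suc_right .
qed simp

text \<open>
  Only the first \<open>N\<close> generating values are controlled, so the bound covers in row
  \<open>s * u\<close> just the entries that depend on no others. The condition on \<open>u\<close> stops the
  descent once the bound is \<open>1\<close>: long blocks in \<open>{0, 1}\<close> cannot be avoided.
\<close>

lemma gilbreath_array_maximum_decreases:
  fixes a :: "nat \<Rightarrow> nat"
  defines "g \<equiv> gilbreath_array (\<lambda>n. real (a n))"
  assumes bound: "\<And>j. j \<in> {1..N} \<Longrightarrow> a j \<le> M"
    and no_block: "\<And>u j. u < M - 1 \<Longrightarrow> j \<in> {1..N} \<Longrightarrow>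
      \<exists>k\<in>{j..j+s}. g (s * u) k \<notin> {0, real (M - u)}"
    and "u \<le> M - 1" "j \<ge> 1" "j + s * u \<le> N"
  shows "g (s * u) j \<le> real (M - u)"
  using assms(4-)
proof (induction u arbitrary: j)
  case 0
  then show ?case using bound[of j] by (simp add: g_def)
next
  case (Suc u)
  let ?m = "real (M - u)" and ?d = "g (s * u)"
  have Z: "g i k \<in> \<int>" for i k
    unfolding g_def by (intro gilbreath_array_Ints) auto
  have nonneg: "g i k \<ge> 0" for i k
    unfolding g_def by (cases i) auto
  have range: "0 \<le> ?d k \<and> ?d k \<le> ?m" if "k \<in> {j..j+s}" for k
    using Suc.IH[of k] Suc.prems that nonneg by simp
  have eq: "g (s * Suc u) j = gilbreath_array ?d s j"
    unfolding g_def by (simp add: gilbreath_array_add[symmetric] add.commute)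
  have "g (s * Suc u) j \<noteq> ?m"
  proof
    assume "g (s * Suc u) j = ?m"
    then have "\<forall>k\<in>{j..j+s}. ?d k \<in> {0, ?m}"
      using gilbreath_array_maximum_imp_block[of j s ?d ?m, OF range] Suc.prems eq by simp
    moreover have "\<exists>k\<in>{j..j+s}. ?d k \<notin> {0, ?m}"
      using no_block[of u j] Suc.prems by simp
    ultimately show False by blast
  qed
  moreover have "g (s * Suc u) j \<le> ?m"
    using gilbreath_array_bounds[of j s ?d ?m, OF range] eq by simp
  moreover obtain z where z: "g (s * Suc u) j = of_int z"
    using Z by (metis Ints_cases)
  ultimately have "z \<noteq> int (M - u)" "z \<le> int (M - u)" by auto
  then have "z \<le> int (M - Suc u)" using Suc.prems by simp
  then show ?case unfolding z by linarith
qed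

section \<open>Blocks with only two values are unlikely\<close>

context prob_space
begin

text \<open>
  Conditioning on the value of \<open>Y\<close>, where \<open>X\<close> has to fall into a set that depends on
  that value. The values of \<open>Y\<close> form a countable set, so a sum over them replaces a
  conditional probability.
\<close>

lemma prob_le_of_conditional_le:
  assumes indep: "indep_var (count_space \<Omega>) Y (count_space \<Psi>) X"
    and "countable \<Omega>" "c \<ge> 0" "\<And>y. S y \<subseteq> \<Psi>"
    and le: "\<And>y. y \<in> \<Omega> \<Longrightarrow> P y \<Longrightarrow> prob {\<omega>\<in>space M. X \<omega> \<in> S y} \<le> c"
  shows "prob {\<omega>\<in>space M. P (Y \<omega>) \<and> X \<omega> \<in> S (Y \<omega>)} \<le> c * prob {\<omega>\<in>space M. P (Y \<omega>)}"
proof -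
  have [measurable]: "Y \<in> measurable M (count_space \<Omega>)" "X \<in> measurable M (count_space \<Psi>)"
    using indep_var_rv1[OF indep] indep_var_rv2[OF indep] by auto
  have Y: "Y \<omega> \<in> \<Omega>" if "\<omega> \<in> space M" for \<omega>
    using measurable_space[OF \<open>Y \<in> measurable M (count_space \<Omega>)\<close> that] by simp
  define I where "I = {y\<in>\<Omega>. P y}"
  have I: "countable I" "I \<subseteq> \<Omega>" using \<open>countable \<Omega>\<close> by (auto simp: I_def)
  define A where "A y = {\<omega>\<in>space M. Y \<omega> = y}" for y
  define B where "B y = {\<omega>\<in>space M. X \<omega> \<in> S y}" for y
  have A: "A y \<in> sets M" if "y \<in> I" for y
  proof -
    have "A y = Y -` {y} \<inter> space M" by (auto simp: A_def)
    also have "\<dots> \<in> sets M"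
      by (rule measurable_sets[of _ _ "count_space \<Omega>"]) (use that I in auto)
    finally show ?thesis .
  qed
  have B: "B y \<in> sets M" for y
  proof -
    have "B y = X -` S y \<inter> space M" by (auto simp: B_def)
    also have "\<dots> \<in> sets M"
      by (rule measurable_sets[of _ _ "count_space \<Psi>"]) (use \<open>S y \<subseteq> \<Psi>\<close> in auto)
    finally show ?thesis .
  qed
  have factor: "emeasure M (A y \<inter> B y) \<le> ennreal c * emeasure M (A y)" if "y \<in> I" for y
  proof -
    have "prob (A y \<inter> B y) = prob ((\<lambda>x. (Y x, X x)) -` ({y} \<times> S y) \<inter> space M)"
      by (intro arg_cong[where f=prob]) (auto simp: A_def B_def)
    also have "\<dots> = prob (Y -` {y} \<inter> space M) * prob (X -` S y \<inter> space M)"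
      by (rule indep_varD[OF indep]) (use that I \<open>S y \<subseteq> \<Psi>\<close> in auto)
    also have "\<dots> = prob (A y) * prob (B y)"
      by (intro arg_cong2[where f="(*)"] arg_cong[where f=prob]) (auto simp: A_def B_def)
    also have "\<dots> \<le> c * prob (A y)"
      using mult_right_mono[OF le[of y], of "prob (A y)"] that by (simp add: B_def I_def mult.commute)
    finally show ?thesis
      using \<open>c \<ge> 0\<close> by (simp add: emeasure_eq_measure ennreal_mult[symmetric] ennreal_leI)
  qed
  have "emeasure M {\<omega>\<in>space M. P (Y \<omega>) \<and> X \<omega> \<in> S (Y \<omega>)} = emeasure M (\<Union>y\<in>I. A y \<inter> B y)"
    by (intro arg_cong[where f="emeasure M"]) (auto simp: A_def B_def I_def Y)
  also have "\<dots> = (\<integral>\<^sup>+y. emeasure M (A y \<inter> B y) \<partial>count_space I)"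
    using A B I by (intro emeasure_UN_countable) (auto simp: disjoint_family_on_def A_def)
  also have "\<dots> \<le> (\<integral>\<^sup>+y. ennreal c * emeasure M (A y) \<partial>count_space I)"
    by (intro nn_integral_mono) (use factor in auto)
  also have "\<dots> = ennreal c * (\<integral>\<^sup>+y. emeasure M (A y) \<partial>count_space I)"
    by (intro nn_integral_cmult) auto
  also have "(\<integral>\<^sup>+y. emeasure M (A y) \<partial>count_space I) = emeasure M (\<Union>y\<in>I. A y)"
    using A I by (intro emeasure_UN_countable[symmetric]) (auto simp: disjoint_family_on_def A_def)
  also have "(\<Union>y\<in>I. A y) = {\<omega>\<in>space M. P (Y \<omega>)}"
    by (auto simp: A_def I_def Y)
  finally show ?thesis
    using \<open>c \<ge> 0\<close> by (simp add: emeasure_eq_measure ennreal_mult[symmetric])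
qed

lemma gilbreath_array_measurable:
  assumes "indep_vars (\<lambda>_. count_space UNIV) a {1..}" "j \<ge> 1"
  shows "(\<lambda>\<omega>. gilbreath_array (\<lambda>n. real (a n \<omega>)) i j) \<in> borel_measurable M"
  using assms(2)
proof (induction i arbitrary: j)
  case 0
  then have [measurable]: "a j \<in> measurable M (count_space UNIV)"
    using assms(1) by (auto simp: indep_vars_def)
  show ?case by simp
next
  case (Suc i)
  have [measurable]: "(\<lambda>\<omega>. gilbreath_array (\<lambda>n. real (a n \<omega>)) i j) \<in> borel_measurable M"
    "(\<lambda>\<omega>. gilbreath_array (\<lambda>n. real (a n \<omega>)) i (Suc j)) \<in> borel_measurable M"
    using Suc by auto
  show ?case by simp
qed

text \<open>
  The entry at \<open>j + t\<close> of row \<open>r\<close> depends on the generating values up to index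
  \<open>j + r + t\<close>. Once the values before index \<open>j + r\<close> are given, every entry of the block
  thus brings in exactly one new value, which is independent of all that determines the previous
  entries.
\<close>

lemma prob_gilbreath_block_le:
  fixes a :: "nat \<Rightarrow> 'a \<Rightarrow> nat"
  assumes indep: "indep_vars (\<lambda>_. count_space UNIV) a {1..}"
    and "j \<ge> 1" "m \<ge> 2" "c \<ge> 0"
    and sparse: "\<And>n S. n \<ge> j + r \<Longrightarrow> (\<And>x. x \<in> S \<Longrightarrow> Suc x \<notin> S) \<Longrightarrow>
      prob {\<omega>\<in>space M. a n \<omega> \<in> S} \<le> c"
  shows "prob {\<omega>\<in>space M. \<forall>t<L. gilbreath_array (\<lambda>n. real (a n \<omega>)) r (j + t) \<in> {0, m}} \<le> c ^ L"
proof (induction L)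
  case 0
  then show ?case by simp
next
  case (Suc L)
  \<comment> \<open>\<open>Y\<close> is the past, \<open>X\<close> the one new value; both are restrictions of the sequence to a set of
    indices, since independence relates random variables of the same type.\<close>
  define n where "n = j + r + L"
  define D where "D = {1..<n}"
  define \<Omega> where "\<Omega> = PiE D (\<lambda>_. UNIV :: nat set)"
  define Y where "Y \<omega> = restrict (\<lambda>i. a i \<omega>) D" for \<omega>
  define P where "P y \<longleftrightarrow> (\<forall>t<L. gilbreath_array (\<lambda>i. real (y i)) r (j + t) \<in> {0, m})" for y :: "nat \<Rightarrow> nat"
  define S where "S y = {x. gilbreath_array ((\<lambda>i. real (y i))(n := real x)) r (j + L) \<in> {0, m}}"
    for y :: "nat \<Rightarrow> nat"
  have n: "n \<ge> 1" using \<open>j \<ge> 1\<close> by (simp add: n_def)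
  define X where "X \<omega> = restrict (\<lambda>i. a i \<omega>) {n}" for \<omega>
  define \<Psi> where "\<Psi> = PiE {n} (\<lambda>_. UNIV :: nat set)"
  have "indep_var (PiM D (\<lambda>_. count_space UNIV)) Y (PiM {n} (\<lambda>_. count_space UNIV)) X"
    unfolding X_def Y_def by (rule indep_var_restrict[OF indep]) (use n in \<open>auto simp: D_def\<close>)
  then have indep': "indep_var (count_space \<Omega>) Y (count_space \<Psi>) X"
    by (simp add: \<Omega>_def \<Psi>_def D_def count_space_PiM_finite)
  have X: "X \<omega> \<in> {f\<in>\<Psi>. f n \<in> S y} \<longleftrightarrow> a n \<omega> \<in> S y" for \<omega> y
    by (auto simp: X_def \<Psi>_def)
  have P: "P (Y \<omega>) \<longleftrightarrow> (\<forall>t<L. gilbreath_array (\<lambda>i. real (a i \<omega>)) r (j + t) \<in> {0, m})" for \<omega>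
  proof -
    have "gilbreath_array (\<lambda>i. real (Y \<omega> i)) r (j + t)
        = gilbreath_array (\<lambda>i. real (a i \<omega>)) r (j + t)" if "t < L" for t
      by (intro gilbreath_array_cong) (use that \<open>j \<ge> 1\<close> in \<open>auto simp: Y_def D_def n_def\<close>)
    then show ?thesis by (simp add: P_def)
  qed
  have S: "a n \<omega> \<in> S (Y \<omega>) \<longleftrightarrow> gilbreath_array (\<lambda>i. real (a i \<omega>)) r (j + L) \<in> {0, m}" for \<omega>
  proof -
    have "gilbreath_array ((\<lambda>i. real (Y \<omega> i))(n := real (a n \<omega>))) r (j + L)
        = gilbreath_array (\<lambda>i. real (a i \<omega>)) r (j + L)"
      by (intro gilbreath_array_cong) (use \<open>j \<ge> 1\<close> in \<open>auto simp: Y_def D_def n_def\<close>)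
    then show ?thesis by (simp add: S_def)
  qed
  have "prob {\<omega>\<in>space M. a n \<omega> \<in> S y} \<le> c" for y
  proof (rule sparse)
    fix x assume "x \<in> S y"
    moreover have "\<bar>gilbreath_array ((\<lambda>i. real (y i))(n := real (Suc x))) r (j + L)
        - gilbreath_array ((\<lambda>i. real (y i))(n := real x)) r (j + L)\<bar> = 1"
      using gilbreath_array_fun_upd_Suc[of "\<lambda>i. real (y i)" "j + L" r x]
      by (simp add: n_def add_ac)
    ultimately show "Suc x \<notin> S y"
      using \<open>m \<ge> 2\<close> unfolding S_def by auto
  qed (simp add: n_def)
  then have "prob {\<omega>\<in>space M. P (Y \<omega>) \<and> X \<omega> \<in> {f\<in>\<Psi>. f n \<in> S (Y \<omega>)}}
      \<le> c * prob {\<omega>\<in>space M. P (Y \<omega>)}"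
    using \<open>c \<ge> 0\<close> unfolding X[symmetric]
    by (intro prob_le_of_conditional_le[OF indep'])
      (auto simp: \<Omega>_def D_def intro!: countable_PiE)
  also have "\<dots> \<le> c * c ^ L"
    using Suc \<open>c \<ge> 0\<close> by (intro mult_left_mono) (simp_all add: P)
  also have "{\<omega>\<in>space M. P (Y \<omega>) \<and> X \<omega> \<in> {f\<in>\<Psi>. f n \<in> S (Y \<omega>)}}
    = {\<omega>\<in>space M. \<forall>t<Suc L. gilbreath_array (\<lambda>n. real (a n \<omega>)) r (j + t) \<in> {0, m}}"
    unfolding X by (auto simp: P S less_Suc_eq)
  finally show ?case by simp
qed

section \<open>Geometric random variables\<close>

lemma prob_image_Suc_geometric:
  fixes X :: "'a \<Rightarrow> nat"
  assumes X [measurable]: "X \<in> measurable M (count_space UNIV)"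
    and geo: "\<And>k. prob {\<omega>\<in>space M. X \<omega> = k} = q ^ k * p"
  shows "prob {\<omega>\<in>space M. X \<omega> \<in> Suc ` S} = q * prob {\<omega>\<in>space M. X \<omega> \<in> S}"
proof -
  have sums: "(\<lambda>k. if k \<in> T then q ^ k * p else 0) sums prob {\<omega>\<in>space M. X \<omega> \<in> T}" for T
  proof -
    have "(\<lambda>k. prob {\<omega>\<in>space M. X \<omega> = k \<and> k \<in> T}) sums
        prob (\<Union>k. {\<omega>\<in>space M. X \<omega> = k \<and> k \<in> T})"
      by (intro finite_measure_UNION) (auto simp: disjoint_family_on_def)
    also have "(\<Union>k. {\<omega>\<in>space M. X \<omega> = k \<and> k \<in> T}) = {\<omega>\<in>space M. X \<omega> \<in> T}" by auto
    also have "(\<lambda>k. prob {\<omega>\<in>space M. X \<omega> = k \<and> k \<in> T}) = (\<lambda>k. if k \<in> T then q ^ k * p else 0)"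
      by (auto simp: fun_eq_iff geo)
    finally show ?thesis .
  qed
  have "(\<lambda>k. if Suc k \<in> Suc ` S then q ^ Suc k * p else 0) = (\<lambda>k. q * (if k \<in> S then q ^ k * p else 0))"
    by auto
  then have "(\<lambda>k. if Suc k \<in> Suc ` S then q ^ Suc k * p else 0) sums (q * prob {\<omega>\<in>space M. X \<omega> \<in> S})"
    using sums_mult[OF sums[of S], of q] by simp
  then have "(\<lambda>k. if k \<in> Suc ` S then q ^ k * p else 0) sums (q * prob {\<omega>\<in>space M. X \<omega> \<in> S})"
    by (subst (asm) sums_Suc_iff) auto
  with sums[of "Suc ` S"] show ?thesis by (rule sums_unique2)
qed

lemma prob_atLeast_geometric:
  fixes X :: "'a \<Rightarrow> nat"
  assumes "X \<in> measurable M (count_space UNIV)"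
    and "\<And>k. prob {\<omega>\<in>space M. X \<omega> = k} = q ^ k * p"
  shows "prob {\<omega>\<in>space M. X \<omega> \<ge> k} = q ^ k"
proof (induction k)
  case (Suc k)
  have "Suc k \<le> x \<longleftrightarrow> x \<in> Suc ` {k..}" for x
    by (cases x) auto
  then have "{\<omega>\<in>space M. X \<omega> \<ge> Suc k} = {\<omega>\<in>space M. X \<omega> \<in> Suc ` {k..}}" by simp
  with prob_image_Suc_geometric[OF assms, of "{k..}"] Suc show ?case by simp
qed (simp add: prob_space)

text \<open>
  The shifted set \<open>Suc ` S\<close> is disjoint from \<open>S\<close> and carries \<open>q\<close> times its
  probability, while both together have probability at most one. The bound is attained by the
  set of even numbers.
\<close>

lemma prob_sparse_geometric_le:
  fixes X :: "'a \<Rightarrow> nat"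
  assumes [measurable]: "X \<in> measurable M (count_space UNIV)"
    and geo: "\<And>k. prob {\<omega>\<in>space M. X \<omega> = k} = q ^ k * p"
    and "q \<ge> 0" and sparse: "\<And>x. x \<in> S \<Longrightarrow> Suc x \<notin> S"
  shows "prob {\<omega>\<in>space M. X \<omega> \<in> S} \<le> 1 / (1 + q)"
proof -
  have "(1 + q) * prob {\<omega>\<in>space M. X \<omega> \<in> S}
      = prob {\<omega>\<in>space M. X \<omega> \<in> S} + prob {\<omega>\<in>space M. X \<omega> \<in> Suc ` S}"
    using prob_image_Suc_geometric[OF assms(1) geo, of S] by (simp add: algebra_simps)
  also have "\<dots> = prob ({\<omega>\<in>space M. X \<omega> \<in> S} \<union> {\<omega>\<in>space M. X \<omega> \<in> Suc ` S})"
    by (rule finite_measure_Union[symmetric]) (use sparse in auto)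
  also have "\<dots> \<le> 1" by simp
  finally show ?thesis using \<open>q \<ge> 0\<close> by (simp add: field_simps)
qed

end

section \<open>The left diagonal\<close>

lemma summable_failure_bound:
  "summable (\<lambda>i. real (i + 1) * exp (- 2 * sqrt (real i) / (2 + ln (real (i + 1))))
    + real (i + 1) ^ 2 * (3 / 4) powr (sqrt (real i) - 2))"
proof (rule summable_comparison_test_bigo)
  show "summable (\<lambda>n. norm (1 / real n ^ 2))"
    using inverse_power_summable[of 2, where ?'a=real] by (simp add: inverse_eq_divide)
qed real_asymp


text \<open>
  The first term bounds the probability that one of the values that the entry depends on exceeds
  \<open>s\<close>, the second that a block occurs which would stop the descent of the maximum; \<open>s\<close>
  is the integer part of \<open>sqrt i\<close>, since both the initial maximum \<open>s\<close> and the block length have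
  to be large while about \<open>s\<^sup>2\<close> rows are available.
\<close>

lemma (in prob_space) prob_gilbreath_array_diagonal_le:
  fixes a :: "nat \<Rightarrow> 'a \<Rightarrow> nat"
  assumes indep: "indep_vars (\<lambda>_. count_space UNIV) a {1..}"
    and geo: "\<And>n k. n \<ge> 1 \<Longrightarrow> prob {\<omega>\<in>space M. a n \<omega> = k}
        = (1 - 2 / (2 + ln (real n))) ^ k * (2 / (2 + ln (real n)))"
  shows "prob {\<omega>\<in>space M. gilbreath_array (\<lambda>n. real (a n \<omega>)) i 1 \<notin> {0, 1}}
    \<le> real (i + 1) * exp (- 2 * sqrt (real i) / (2 + ln (real (i + 1))))
      + real (i + 1) ^ 2 * (3 / 4) powr (sqrt (real i) - 2)"
proof -
  define g where "g r j \<omega> = gilbreath_array (\<lambda>n. real (a n \<omega>)) r j" for r j \<omega>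
  define q where "q n = 1 - 2 / (2 + ln (real n))" for n
  define N where "N = i + 1"
  define s where "s = nat \<lfloor>sqrt (real i)\<rfloor>"
  have s_le: "real s \<le> sqrt (real i)" and s_ge: "sqrt (real i) < real s + 1"
    by (simp_all add: s_def)
  have "real (s * s) \<le> real i"
    using mult_mono[OF s_le s_le] by simp
  then have ss: "s * s \<le> i" by linarith
  have [measurable]: "a n \<in> measurable M (count_space UNIV)" if "n \<ge> 1" for n
    using that indep by (auto simp: indep_vars_def)
  have [measurable]: "g r j \<in> borel_measurable M" if "j \<ge> 1" for r j
    using gilbreath_array_measurable[OF indep that] by (simp add: g_def[abs_def])
  have q_nonneg: "q n \<ge> 0" if "n \<ge> 1" for n
  proof -
    have "0 \<le> ln (real n)" using that by simp
    then show ?thesis by (simp add: q_def field_simps)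
  qed
  have q_mono: "q n \<le> q N" if "n \<ge> 1" "n \<le> N" for n
    using that unfolding q_def by (intro diff_left_mono divide_left_mono) (auto intro!: mult_pos_pos add_pos_nonneg)
  have q_third: "1 / (1 + q n) \<le> 3 / 4" if "n \<ge> 3" for n
  proof -
    have "exp 1 \<le> real n" using exp_le that by linarith
    then have "1 \<le> ln (real n)" using that by (subst ln_ge_iff) auto
    then have "q n \<ge> 1 / 3" by (simp add: q_def field_simps)
    then show ?thesis by (simp add: field_simps)
  qed
  define Large where "Large j = {\<omega>\<in>space M. a j \<omega> \<ge> Suc s}" for j
  \<comment> \<open>A bad block at \<open>j\<close> consists of \<open>s + 1\<close> entries. Only the last \<open>s - 1\<close> are used, because the
    generating values that they bring in have index at least \<open>3\<close>, where the factor \<open>3/4\<close> is valid.\<close>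
  define Block where "Block u j = {\<omega>\<in>space M. \<forall>t<s - 1. g (s * u) (j + 2 + t) \<omega> \<in> {0, real (s - u)}}" for u j
  have Large: "prob (Large j) \<le> exp (- 2 * sqrt (real i) / (2 + ln (real N)))" if "j \<in> {1..N}" for j
  proof -
    have "prob (Large j) = q j ^ Suc s"
      unfolding Large_def using that geo
      by (intro prob_atLeast_geometric[where p = "2 / (2 + ln (real j))"]) (auto simp: q_def)
    also have "\<dots> \<le> q N ^ Suc s"
      using that by (intro power_mono q_nonneg q_mono) auto
    also have "\<dots> \<le> exp (- (2 / (2 + ln (real N)))) ^ Suc s"
      using exp_ge_add_one_self[of "- (2 / (2 + ln (real N)))"] q_nonneg[of N]
      by (intro power_mono) (auto simp: q_def N_def)
    also have "\<dots> = exp (- (real (Suc s) * (2 / (2 + ln (real N)))))"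
      by (simp only: exp_of_nat_mult[symmetric]) simp
    also have "\<dots> \<le> exp (- (sqrt (real i) * (2 / (2 + ln (real N)))))"
      using s_ge unfolding exp_le_cancel_iff neg_le_iff_le
      by (intro mult_right_mono) (auto simp: N_def intro!: divide_nonneg_nonneg add_nonneg_nonneg)
    finally show ?thesis by (simp add: mult_ac)
  qed
  have Block: "prob (Block u j) \<le> (3 / 4) powr (sqrt (real i) - 2)" if "u < s - 1" "j \<ge> 1" for u j
  proof -
    have "prob (Block u j) \<le> (3 / 4) ^ (s - 1)"
      unfolding Block_def g_def
    proof (rule prob_gilbreath_block_le[OF indep])
      fix n and S :: "nat set"
      assume n: "n \<ge> j + 2 + s * u" and S: "\<And>x. x \<in> S \<Longrightarrow> Suc x \<notin> S"
      have "prob {\<omega>\<in>space M. a n \<omega> \<in> S} \<le> 1 / (1 + q n)"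
        using n \<open>j \<ge> 1\<close> geo[of n]
        by (intro prob_sparse_geometric_le[where p = "2 / (2 + ln (real n))"] S q_nonneg)
          (auto simp: q_def)
      also have "\<dots> \<le> 3 / 4" using n \<open>j \<ge> 1\<close> by (intro q_third) simp
      finally show "prob {\<omega>\<in>space M. a n \<omega> \<in> S} \<le> 3 / 4" .
    qed (use that in auto)
    also have "\<dots> = (3 / 4) powr real (s - 1)" by (simp add: powr_realpow)
    also have "\<dots> \<le> (3 / 4) powr (sqrt (real i) - 2)"
      using s_ge by (intro powr_mono') auto
    finally show ?thesis .
  qed
  have "{\<omega>\<in>space M. g i 1 \<omega> \<notin> {0, 1}} \<subseteq> (\<Union>j\<in>{1..N}. Large j) \<union> (\<Union>(u, j)\<in>{..<s - 1} \<times> {1..N}. Block u j)"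
  proof (rule subsetI, rule ccontr)
    fix \<omega> assume \<omega>: "\<omega> \<in> {\<omega>\<in>space M. g i 1 \<omega> \<notin> {0, 1}}"
      and good: "\<omega> \<notin> (\<Union>j\<in>{1..N}. Large j) \<union> (\<Union>(u, j)\<in>{..<s - 1} \<times> {1..N}. Block u j)"
    let ?r = "s * (s - 1)"
    have r: "?r \<le> i" using ss by (simp add: right_diff_distrib')
    have small: "a j \<omega> \<le> s" if "j \<in> {1..N}" for j
      using good that \<omega> by (force simp: Large_def)
    have no_block: "\<exists>k\<in>{j..j+s}. gilbreath_array (\<lambda>n. real (a n \<omega>)) (s * u) k \<notin> {0, real (s - u)}"
      if "u < s - 1" "j \<in> {1..N}" for u j
    proof -
      have "\<omega> \<notin> Block u j" using good that by auto
      then obtain t where "t < s - 1" "g (s * u) (j + 2 + t) \<omega> \<notin> {0, real (s - u)}"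
        using \<omega> by (auto simp: Block_def)
      then show ?thesis by (intro bexI[of _ "j + 2 + t"]) (auto simp: g_def)
    qed
    have le1: "g ?r k \<omega> \<le> 1" if "k \<in> {1..1 + (i - ?r)}" for k
    proof -
      have "g ?r k \<omega> \<le> real (s - (s - 1))"
        unfolding g_def
        by (rule gilbreath_array_maximum_decreases[where a = "\<lambda>n. a n \<omega>", OF small no_block])
          (use that r in \<open>auto simp: N_def\<close>)
      also have "\<dots> \<le> 1" by simp
      finally show ?thesis .
    qed
    have nonneg: "g r k \<omega> \<ge> 0" for r k
      unfolding g_def by (cases r) auto
    have "g i 1 \<omega> = gilbreath_array (\<lambda>k. g ?r k \<omega>) (i - ?r) 1"
      using r gilbreath_array_add[of "\<lambda>n. real (a n \<omega>)" ?r "i - ?r" 1] by (simp add: g_def)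
    then have "0 \<le> g i 1 \<omega>" "g i 1 \<omega> \<le> 1"
      using gilbreath_array_bounds[of 1 "i - ?r" "\<lambda>k. g ?r k \<omega>" 1] le1 nonneg by auto
    moreover have "g i 1 \<omega> \<in> \<int>"
      unfolding g_def by (intro gilbreath_array_Ints) auto
    ultimately have "g i 1 \<omega> \<in> {0, 1}" by (auto elim!: Ints_cases)
    with \<omega> show False by simp
  qed
  then have "prob {\<omega>\<in>space M. g i 1 \<omega> \<notin> {0, 1}}
      \<le> prob ((\<Union>j\<in>{1..N}. Large j) \<union> (\<Union>(u, j)\<in>{..<s - 1} \<times> {1..N}. Block u j))"
    by (rule finite_measure_mono) (auto simp: Large_def Block_def intro!: sets.finite_UN sets.Un)
  also have "\<dots> \<le> prob (\<Union>j\<in>{1..N}. Large j) + prob (\<Union>(u, j)\<in>{..<s - 1} \<times> {1..N}. Block u j)"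
    by (rule measure_Un_le) (auto simp: Large_def Block_def intro!: sets.finite_UN)
  also have "prob (\<Union>j\<in>{1..N}. Large j) \<le> (\<Sum>j\<in>{1..N}. prob (Large j))"
    by (rule finite_measure_subadditive_finite) (auto simp: Large_def)
  also have "\<dots> \<le> (\<Sum>j\<in>{1..N}. exp (- 2 * sqrt (real i) / (2 + ln (real N))))"
    by (rule sum_mono) (rule Large)
  also have "prob (\<Union>(u, j)\<in>{..<s - 1} \<times> {1..N}. Block u j)
      \<le> (\<Sum>(u, j)\<in>{..<s - 1} \<times> {1..N}. prob (Block u j))"
    unfolding split_def by (rule finite_measure_subadditive_finite) (auto simp: Block_def)
  also have "\<dots> \<le> (\<Sum>(u, j)\<in>{..<s - 1} \<times> {1..N}. (3 / 4) powr (sqrt (real i) - 2))"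
    unfolding split_def by (rule sum_mono) (use Block in auto)
  also have "\<dots> \<le> real N ^ 2 * (3 / 4) powr (sqrt (real i) - 2)"
  proof -
    have "s \<le> i" using ss by (cases s) auto
    then have "real (s - 1) * real N \<le> real N ^ 2"
      by (auto simp: N_def power2_eq_square intro!: mult_right_mono)
    then show ?thesis by (simp add: mult_right_mono split_def)
  qed
  finally show ?thesis by (simp add: g_def N_def)
qed

theorem theorem1p2:
  fixes M :: "'w measure" and a :: "nat \<Rightarrow> 'w \<Rightarrow> nat"
  assumes "prob_space M"
    and "prob_space.indep_vars M (\<lambda>_. count_space UNIV) a {1..}"
    and "\<And>n k. n \<ge> 1 \<Longrightarrow>
      measure M {\<omega> \<in> space M. a n \<omega> = k}
        = (1 - 2 / (2 + ln (real n))) ^ k * (2 / (2 + ln (real n)))"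
  shows "AE \<omega> in M. \<exists>i\<^sub>0. \<forall>i\<ge>i\<^sub>0. gilbreath_array (\<lambda>n. real (a n \<omega>)) i 1 \<in> {0, 1}"
proof -
  interpret prob_space M by fact
  let ?F = "\<lambda>i. {\<omega>\<in>space M. gilbreath_array (\<lambda>n. real (a n \<omega>)) i 1 \<notin> {0, 1}}"
  have F: "?F i \<in> sets M" for i
  proof -
    have [measurable]: "(\<lambda>\<omega>. gilbreath_array (\<lambda>n. real (a n \<omega>)) i 1) \<in> borel_measurable M"
      using gilbreath_array_measurable[OF assms(2)] by simp
    show ?thesis by measurable
  qed
  have "summable (\<lambda>i. prob (?F i))"
    by (rule summable_comparison_test'[OF summable_failure_bound, of 0])
      (use prob_gilbreath_array_diagonal_le[OF assms(2,3)] in simp)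
  then have "AE \<omega> in M. eventually (\<lambda>i. \<omega> \<in> space M - ?F i) sequentially"
    by (intro borel_cantelli_AE1) (use F in \<open>auto simp: emeasure_eq_measure\<close>)
  then show ?thesis
    by eventually_elim (auto simp: eventually_sequentially)
qed

end
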